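(* Let $\Phi\colon\mathbf H_2\to\mathbf H_2$ be a map on the set $\mathbf H_2$ of $2\times2$ complex Hermitian matrices (not assumed linear or surjective). The following statements are equivalent. (1) $\sigma([\Phi(A),\Phi(B)])=\sigma([A,B])$ for all $A,B\in\mathbf H_2$. (2) $W([\Phi(A),\Phi(B)])=W([A,B])$ for all $A,B\in\mathbf H_2$. (3) $w([\Phi(A),\Phi(B)])=w([A,B])$ for all $A,B\in\mathbf H_2$. (4) There exist a unitary matrix $U\in M_2(\mathbb C)$, a function $h\colon\mathbf H_2\to\{-1,1\}$ and a function $f\colon\mathbf H_2\to\mathbb R$ such that one of the following holds: (1$^\circ$) $\Phi(A)=h(A)\,UAU^*+f(A)I$ for all $A\in\mathbf H_2$; (2$^\circ$) $\Phi(A)=h(A)\,UA^tU^*+f(A)I$ for all $A\in\mathbf H_2$; (3$^\circ$) $\Phi(A)=h(A)\,U\Psi(A)U^*+f(A)I$ for all $A\in\mathbf H_2$; (4$^\circ$) $\Phi(A)=h(A)\,U\Psi(A)^tU^*+f(A)I$ for all $A\in\mathbf H_2$. Here $\Psi\colon\mathbf H_2\to\mathbf H_2$ is the map given, for $a,b,c,d\in\mathbb R$, by $$\Psi\begin{pmatrix}a&c+id\\ c-id&b\end{pmatrix}=\begin{pmatrix}a&-c+id\\ -c-id&b\end{pmatrix}.$$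
   Context: $\mathbf H_2=\mathbf H_2(\mathbb C)$ is the set of all $2\times 2$ Hermitian matrices over $\mathbb C$; $M_2(\mathbb C)$ is the set of all $2\times2$ complex matrices; $I$ is the identity matrix; $A^t$ is the usual transpose of $A$. $[A,B]=AB-BA$ is the Lie product and $\sigma(A)$ is the spectrum of $A$. The numerical range is $W(A)=\{\langle Ax,x\rangle : x\in\mathbb C^2,\ \|x\|=1\}$ and the numerical radius is $w(A)=\sup\{|\lambda| : \lambda\in W(A)\}$. *)

theory Defs
  imports "HOL-Analysis.Analysis"
begin

definition adj :: "complex^'n^'m \<Rightarrow> complex^'m^'n" where
  "adj A = (\<chi> i j. cnj (A $ j $ i))"

definition hermitian :: "(complex^'n^'n) set" where
  "hermitian = {A. adj A = A}"

abbreviation H2 :: "(complex^2^2) set" where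
  "H2 \<equiv> hermitian"

definition unitary :: "complex^'n^'n \<Rightarrow> bool" where
  "unitary U \<longleftrightarrow> adj U ** U = mat 1 \<and> U ** adj U = mat 1"

definition lie :: "complex^'n^'n \<Rightarrow> complex^'n^'n \<Rightarrow> complex^'n^'n" where
  "lie A B = A ** B - B ** A"

definition spectrum :: "complex^'n^'n \<Rightarrow> complex set" where
  "spectrum A = {z. \<not> invertible (A - mat z)}"

text \<open>The library's inner product on this type is real-valued; the Hermitian one, linear in the
  first argument, is needed here. The library norm on the type is the one it induces.\<close>

definition herm_inner :: "complex^'n \<Rightarrow> complex^'n \<Rightarrow> complex" where
  "herm_inner x y = (\<Sum>i\<in>UNIV. x $ i * cnj (y $ i))"

lemma herm_inner_self: "herm_inner x x = of_real ((norm x)\<^sup>2)"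
proof -
  have "(norm x)\<^sup>2 = (\<Sum>i\<in>UNIV. (cmod (x $ i))\<^sup>2)"
    unfolding norm_vec_def L2_set_def by (intro real_sqrt_pow2 sum_nonneg) simp
  then show ?thesis
    unfolding herm_inner_def by (simp only: of_real_sum complex_norm_square)
qed

definition num_range :: "complex^'n^'n \<Rightarrow> complex set" where
  "num_range A = {herm_inner (A *v x) x | x. norm x = 1}"

definition num_radius :: "complex^'n^'n \<Rightarrow> real" where
  "num_radius A = (SUP z\<in>num_range A. cmod z)"

text \<open>The supremum is over a nonempty bounded set, hence a genuine one.\<close>

lemma num_range_nonempty:
  fixes A :: "complex^'n^'n"
  shows "num_range A \<noteq> {}"
proof -
  obtain x :: "complex^'n" where "norm x = 1"
    using vector_choose_size[of 1] zero_le_one by metis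
  then show ?thesis
    unfolding num_range_def by blast
qed

lemma num_range_bdd: "bdd_above (cmod ` num_range A)"
proof -
  have "cmod (herm_inner (A *v x) x) \<le> (\<Sum>i\<in>UNIV. \<Sum>j\<in>UNIV. cmod (A $ i $ j))"
    if "norm x = 1" for x
  proof -
    have le1: "cmod (x $ i) \<le> 1" for i
      using Finite_Cartesian_Product.norm_nth_le[of x i] that by simp
    have "cmod (herm_inner (A *v x) x) \<le> (\<Sum>i\<in>UNIV. cmod ((A *v x) $ i))"
      unfolding herm_inner_def
      by (rule sum_norm_le) (simp add: norm_mult le1 mult_left_le)
    also have "\<dots> \<le> (\<Sum>i\<in>UNIV. \<Sum>j\<in>UNIV. cmod (A $ i $ j))"
      unfolding matrix_vector_mult_def
      by (intro sum_mono) (auto intro!: sum_norm_le simp: norm_mult le1 mult_left_le)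
    finally show ?thesis .
  qed
  then show ?thesis
    unfolding num_range_def bdd_above_def by auto
qed

text \<open>Only the values on \<^term>\<open>H2\<close> matter; there it is the map described by the lemma below.\<close>

definition Psi :: "complex^2^2 \<Rightarrow> complex^2^2" where
  "Psi A = (\<chi> i j. if i = j then A $ i $ j else Complex (- Re (A $ i $ j)) (Im (A $ i $ j)))"

lemma Psi_eq:
  fixes a b c d :: real
  shows "Psi (vector [vector [of_real a, of_real c + \<i> * of_real d],
                      vector [of_real c - \<i> * of_real d, of_real b]])
       = vector [vector [of_real a, - of_real c + \<i> * of_real d],
                 vector [- of_real c - \<i> * of_real d, of_real b]]"
  by (simp add: Psi_def vec_eq_iff forall_2 complex_eq_iff)

lemma H2_iff:
  "A \<in> H2 \<longleftrightarrow> (\<exists>a b c d :: real. A =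
     vector [vector [of_real a, of_real c + \<i> * of_real d],
             vector [of_real c - \<i> * of_real d, of_real b]])"
proof
  assume "A \<in> H2"
  then have "cnj (A $ j $ i) = A $ i $ j" for i j
    by (simp add: hermitian_def adj_def vec_eq_iff)
  from this[of 1 1] this[of 1 2] this[of 2 2]
  have "Im (A $ 1 $ 1) = 0" "Im (A $ 2 $ 2) = 0"
    "Re (A $ 2 $ 1) = Re (A $ 1 $ 2)" "Im (A $ 2 $ 1) = - Im (A $ 1 $ 2)"
    unfolding complex_eq_iff by auto
  then have "A = vector
      [vector [of_real (Re (A$1$1)), of_real (Re (A$1$2)) + \<i> * of_real (Im (A$1$2))],
       vector [of_real (Re (A$1$2)) - \<i> * of_real (Im (A$1$2)), of_real (Re (A$2$2))]]"
    unfolding vec_eq_iff forall_2 by (simp add: complex_eq_iff)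
  then show "\<exists>a b c d :: real. A =
     vector [vector [of_real a, of_real c + \<i> * of_real d],
             vector [of_real c - \<i> * of_real d, of_real b]]" by metis
next
  assume "\<exists>a b c d :: real. A =
     vector [vector [of_real a, of_real c + \<i> * of_real d],
             vector [of_real c - \<i> * of_real d, of_real b]]"
  then obtain a b c d :: real where A: "A =
     vector [vector [of_real a, of_real c + \<i> * of_real d],
             vector [of_real c - \<i> * of_real d, of_real b]]"
    by blast
  show "A \<in> H2"
    unfolding A hermitian_def adj_def mem_Collect_eq vec_eq_iff forall_2 by simp
qed

lemma Psi_in_H2:
  assumes "A \<in> H2"
  shows "Psi A \<in> H2"
proof -
  obtain a b c d :: real where A: "A =
     vector [vector [of_real a, of_real c + \<i> * of_real d],
             vector [of_real c - \<i> * of_real d, of_real b]]"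
    using assms unfolding H2_iff by blast
  have "Psi A = vector [vector [of_real a, of_real (- c) + \<i> * of_real d],
             vector [of_real (- c) - \<i> * of_real d, of_real b]]"
    unfolding A Psi_eq by simp
  then show ?thesis
    unfolding H2_iff by blast
qed

end

theory Submission
  imports Defs
begin

text \<open>Writing \<open>A = v \<cdot> \<sigma> + t I\<close> with the vector of Pauli matrices \<open>\<sigma>\<close>, one has
  \<open>[A, B] = 2 \<i> (u \<times> v) \<cdot> \<sigma>\<close>, a skew-Hermitian matrix with spectrum \<open>{\<plusminus>\<i>s}\<close>, numerical range
  \<open>\<i>[-s, s]\<close> and numerical radius \<open>s = 2 |u \<times> v|\<close>. So (1), (2) and (3) all say that the induced map
  \<open>F\<close> on vectors preserves the areas \<open>|u \<times> v|\<close>. On symmetric matrices \<open>|u \<times> v|\<^sup>2\<close> is the value at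
  \<open>(u u\<^sup>T, v v\<^sup>T)\<close> of the nondegenerate form \<open>tr X tr Y - tr (X Y)\<close>, and the \<open>u u\<^sup>T\<close> span, so there is
  a linear \<open>L\<close> with \<open>F(u) F(u)\<^sup>T = L (u u\<^sup>T)\<close>. Evaluating on the standard basis and its pairwise sums
  shows \<open>F = \<plusminus>T\<close> for a rotation \<open>T\<close>, which lifts to a unitary \<open>U\<close>. Transposition and \<open>\<Psi>\<close> act
  on vectors as reflections, that is as rotations up to sign, so the forms (2), (3) and (4) of the
  classification are already instances of form (1).\<close>

unbundle cross3_syntax

subsection \<open>Maps preserving the norm of the cross product\<close>

text \<open>A basis is picked among the \<open>g i\<close>, and \<open>L\<close> sends each basis
  vector to the matching \<open>g' i\<close>. Equal Gram values make \<open>L\<close> preserve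
  \<open>q\<close> on the basis, hence everywhere; nondegeneracy then gives injectivity, and finite
  dimension surjectivity. So \<open>g' i - L (g i)\<close> pairs to zero with the whole
  space.\<close>

lemma linear_of_gram_eq:
  fixes q :: "'v::euclidean_space \<Rightarrow> 'v \<Rightarrow> real" and g g' :: "'i \<Rightarrow> 'v"
  assumes q: "bilinear q" and nondeg: "\<And>x. (\<And>y. q x y = 0) \<Longrightarrow> x = 0"
    and span: "span (range g) = UNIV"
    and gram: "\<And>i j. q (g' i) (g' j) = q (g i) (g j)"
  obtains L where "linear L" "surj L" "\<And>i. g' i = L (g i)"
proof -
  have q_left: "linear (\<lambda>x. q x y)" and q_right: "linear (q x)" for x y
    using q by (auto simp: bilinear_def)
  obtain B where B: "B \<subseteq> range g" "independent B" "span B = UNIV"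
    using maximal_independent_subset[of "range g"] span
    by (metis span_minimal subspace_span top.extremum_uniqueI)
  have "\<exists>i. b = g i" if "b \<in> B" for b
    using B(1) that by blast
  then obtain k where k: "g (k b) = b" if "b \<in> B" for b
    by metis
  obtain L where L: "linear L" "\<forall>b\<in>B. L b = g' (k b)"
    using linear_independent_extend[OF B(2), of "g' \<circ> k"] by auto
  note comp = linear_compose[unfolded o_def]
  have isometry_B: "q (L b) (L c) = q b c" if "b \<in> B" "c \<in> B" for b c
    using L(2) gram k that by metis
  have "q (L b) (L y) = q b y" if "b \<in> B" for b y
    using linear_eq_on[OF comp[OF L(1) q_right] q_right, of y B] isometry_B that B(3) by blast
  then have isometry: "q (L x) (L y) = q x y" for x y
    using linear_eq_on[OF comp[OF L(1) q_left] q_left, of x B] B(3) by blast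
  have "inj L"
    unfolding linear_injective_0[OF L(1)]
  proof (intro allI impI)
    fix x assume "L x = 0"
    then have "q x y = 0" for y
      using isometry[of x y] linear_0[OF q_left] by metis
    then show "x = 0"
      by (rule nondeg)
  qed
  then have "surj L"
    using L(1) linear_injective_imp_surjective by blast
  moreover have "g' i = L (g i)" for i
  proof -
    have "q (g' i) (L b) = q (L (g i)) (L b)" if "b \<in> B" for b
      using that L(2) gram k isometry by metis
    then have "q (g' i) (L y) = q (L (g i)) (L y)" for y
      using linear_eq_on[OF comp[OF L(1) q_right] comp[OF L(1) q_right], of y B] B(3) by blast
    then have "q (g' i - L (g i)) y = 0" for y
      using \<open>surj L\<close> linear_diff[OF q_left] by (metis eq_iff_diff_eq_0 surjD)
    then have "g' i - L (g i) = 0"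
      by (rule nondeg)
    then show ?thesis by simp
  qed
  ultimately show ?thesis
    using that L(1) by blast
qed

text \<open>Symmetric \<open>3 \<times> 3\<close> matrices \<open>X\<close> are encoded as pairs of diagonal and off-diagonal entries
  \<open>((X\<^sub>1\<^sub>1, X\<^sub>2\<^sub>2, X\<^sub>3\<^sub>3), (X\<^sub>2\<^sub>3, X\<^sub>3\<^sub>1, X\<^sub>1\<^sub>2))\<close>.\<close>

definition outer_square :: "real^3 \<Rightarrow> (real^3) \<times> (real^3)" where
  "outer_square w =
     (vector [(w$1)\<^sup>2, (w$2)\<^sup>2, (w$3)\<^sup>2], vector [w$2 * w$3, w$3 * w$1, w$1 * w$2])"

text \<open>In terms of the encoded symmetric matrices this is
  \<open>tr X * tr Y - tr (X Y)\<close>; the factor 2 is there because each off-diagonal entry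
  occurs twice.\<close>

definition area_form :: "(real^3) \<times> (real^3) \<Rightarrow> (real^3) \<times> (real^3) \<Rightarrow> real" where
  "area_form X Y = (fst X \<bullet> 1) * (fst Y \<bullet> 1) - fst X \<bullet> fst Y - 2 * (snd X \<bullet> snd Y)"

lemma bilinear_area_form: "bilinear area_form"
  unfolding bilinear_def
  by (auto intro!: linearI simp: area_form_def inner_add_left inner_add_right algebra_simps)

lemma area_form_nondegenerate:
  assumes "\<And>Y. area_form X Y = 0"
  shows "X = 0"
proof -
  have "snd X \<bullet> snd X = 0"
    using assms[of "(0, snd X)"] by (simp add: area_form_def)
  moreover have tr: "(fst X \<bullet> 1) * (c \<bullet> 1) = fst X \<bullet> c" for c
    using assms[of "(c, 0)"] by (simp add: area_form_def)
  \<comment> \<open>At \<open>c = 1\<close> the identity reads \<open>3 * t = t\<close> for the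
    trace \<open>t\<close>.\<close>
  have "fst X \<bullet> 1 = 0"
    using tr[of 1] by (simp add: inner_vec_def sum_3)
  then have "fst X \<bullet> fst X = 0"
    using tr[of "fst X"] by simp
  ultimately show ?thesis
    by (simp add: prod_eq_iff)
qed

text \<open>Lagrange's identity: both sides are
  \<open>|u|^2 |v|^2 - (u \<bullet> v)^2\<close>.\<close>

lemma area_form_outer_square: "area_form (outer_square u) (outer_square v) = (norm (u \<times> v))\<^sup>2"
  unfolding power2_norm_eq_inner
  by (simp add: area_form_def outer_square_def inner_vec_def sum_3 cross_components)
    (simp add: power2_eq_square algebra_simps)

text \<open>The square is \<open>z^T (w w^T) z\<close>, hence linear in
  \<open>outer_square w\<close>; this lets squared inner products pass through a linear map on
  symmetric matrices.\<close>

lemma inner_square_eq: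
  "(w \<bullet> z)\<^sup>2 = outer_square w \<bullet> (fst (outer_square z), 2 *\<^sub>R snd (outer_square z))"
  by (simp add: outer_square_def inner_vec_def sum_3 inner_prod_def)
    (simp add: power2_eq_square algebra_simps)

text \<open>Squares of the axis vectors give the diagonal units, their polarisations
  \<open>?m i j\<close> the off-diagonal ones.\<close>

lemma span_outer_squares: "span (range outer_square) = UNIV"
proof -
  let ?S = "span (range outer_square)"
  let ?P = outer_square
  have P: "?P w \<in> ?S" for w
    by (simp add: span_base)
  have "X \<in> ?S" for X
  proof -
    let ?e = "\<lambda>i. axis i 1 :: real^3"
    let ?m = "\<lambda>i j. ?P (?e i + ?e j) - ?P (?e i) - ?P (?e j)"
    have "X = (fst X $ 1) *\<^sub>R ?P (?e 1) + (fst X $ 2) *\<^sub>R ?P (?e 2) + (fst X $ 3) *\<^sub>R ?P (?e 3)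
        + (snd X $ 1) *\<^sub>R ?m 2 3 + (snd X $ 2) *\<^sub>R ?m 3 1 + (snd X $ 3) *\<^sub>R ?m 1 2"
      by (simp add: outer_square_def prod_eq_iff vec_eq_iff forall_3 axis_def)
    also have "\<dots> \<in> ?S"
      by (intro span_add span_scale span_diff P)
    finally show ?thesis .
  qed
  then show ?thesis by blast
qed

lemma cross_norm_preserving_quadratic:
  fixes F v :: "'a \<Rightarrow> real^3"
  assumes "surj v" and "\<And>A B. norm (F A \<times> F B) = norm (v A \<times> v B)"
  obtains L where "linear L" "surj L" "\<And>A. outer_square (F A) = L (outer_square (v A))"
proof (rule linear_of_gram_eq[where q = area_form and g = "outer_square \<circ> v" and g' = "outer_square \<circ> F"])
  show "span (range (outer_square \<circ> v)) = UNIV"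
    using assms(1) span_outer_squares by (metis image_comp)
qed (use that assms(2) in \<open>auto simp: bilinear_area_form area_form_nondegenerate area_form_outer_square\<close>)

section \<open>Recovering the vector map from its squares, up to sign\<close>

text \<open>Testing at \<open>x\<close> and \<open>y\<close> shows that both squared norms are
  \<open>x \<bullet> y\<close> up to sign. As they are nonnegative, the signs agree or everything is
  zero, so \<open>x - y\<close> or \<open>x + y\<close> has norm zero.\<close>

lemma eq_or_eq_minus_if_inner_squares_eq:
  fixes x y :: "'a::real_inner"
  assumes "\<And>z. (x \<bullet> z)\<^sup>2 = (y \<bullet> z)\<^sup>2"
  shows "x = y \<or> x = - y"
proof -
  have "x \<bullet> x = x \<bullet> y \<or> x \<bullet> x = - (x \<bullet> y)" "y \<bullet> y = x \<bullet> y \<or> y \<bullet> y = - (x \<bullet> y)"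
    using assms[of x] assms[of y] by (auto simp: inner_commute power2_eq_iff)
  moreover have "x \<bullet> x \<ge> 0" "y \<bullet> y \<ge> 0"
    by simp_all
  ultimately have "(x - y) \<bullet> (x - y) = 0 \<or> (x + y) \<bullet> (x + y) = 0"
    unfolding inner_diff_left inner_diff_right inner_add_left inner_add_right inner_commute[of y x]
    by argo
  then show ?thesis
    by (simp add: add_eq_0_iff2)
qed

text \<open>Cramer's rule for the vectors \<open>p\<close>, \<open>q\<close>,
  \<open>p \<times> q\<close>, with their determinant \<open>|p \<times> q|^2\<close>
  cleared.\<close>

lemma cross_expansion:
  "((p \<times> q) \<bullet> (p \<times> q)) *\<^sub>R r =
     ((r \<times> q) \<bullet> (p \<times> q)) *\<^sub>R p + ((p \<times> r) \<bullet> (p \<times> q)) *\<^sub>R q + (r \<bullet> (p \<times> q)) *\<^sub>R (p \<times> q)"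
  unfolding vec_eq_iff forall_3
  by (simp add: inner_vec_def sum_3 cross_components) (simp add: algebra_simps)

text \<open>Meant for \<open>p\<close>, \<open>q\<close> the images of two vectors and
  \<open>r\<close>, \<open>s\<close> those of their sum and difference, where \<open>sq\<close> is a
  parallelogram law. It puts \<open>r\<close> into the plane of \<open>p\<close> and
  \<open>q\<close>, and the unit areas force both coefficients to be 1 or -1.\<close>

lemma quadratic_pair_sum_or_diff:
  fixes p q r s :: "real^3"
  assumes sq: "\<And>z. (r \<bullet> z)\<^sup>2 + (s \<bullet> z)\<^sup>2 = 2 * (p \<bullet> z)\<^sup>2 + 2 * (q \<bullet> z)\<^sup>2"
    and pq: "norm (p \<times> q) = 1" and rp: "norm (r \<times> p) = 1" and rq: "norm (r \<times> q) = 1"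
  obtains e :: real where "e \<in> {-1, 1}" "\<And>z. (r \<bullet> z)\<^sup>2 = (p \<bullet> z + e * (q \<bullet> z))\<^sup>2"
proof -
  define a b where "a = (r \<times> q) \<bullet> (p \<times> q)" and "b = (p \<times> r) \<bullet> (p \<times> q)"
  \<comment> \<open>At \<open>z = p \<times> q\<close> the right side of \<open>sq\<close> vanishes,
    hence so does each square on the left.\<close>
  have "r \<bullet> (p \<times> q) = 0"
    using sq[of "p \<times> q"] by (simp add: dot_cross_self add_nonneg_eq_0_iff)
  then have r: "r = a *\<^sub>R p + b *\<^sub>R q"
    using cross_expansion[of p q r] pq unfolding a_def b_def by (simp add: norm_eq_1)
  have "\<bar>a\<bar> = 1"
    using rq pq unfolding r by (simp add: cross_add_left cross_mult_left)
  moreover have "\<bar>b\<bar> = 1"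
    using rp pq cross_skew[of q p] unfolding r by (simp add: cross_add_left cross_mult_left)
  ultimately have ab: "a * a = 1" "a * b \<in> {-1, 1}"
    by (auto simp: abs_if split: if_splits)
  have "(r \<bullet> z)\<^sup>2 = (p \<bullet> z + (a * b) * (q \<bullet> z))\<^sup>2" for z
  proof -
    have "a * (r \<bullet> z) = (a * a) * (p \<bullet> z) + (a * b) * (q \<bullet> z)"
      unfolding r by (simp add: inner_add_left algebra_simps)
    then show ?thesis
      using ab(1) by (metis power_mult_distrib mult_1 power2_eq_square)
  qed
  then show ?thesis
    using that ab(2) by blast
qed

text \<open>\<open>T u \<times> T w\<close> is the cofactor matrix of \<open>T\<close> applied to
  \<open>u \<times> w\<close>, so the columns \<open>n1\<close>, \<open>n2\<close>,
  \<open>n3\<close> of that matrix are orthonormal. Their cross products are \<open>d\<close> times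
  the columns of \<open>T\<close>, with \<open>d\<close> the determinant, which carries
  orthonormality back to \<open>T\<close>.\<close>

lemma orthonormal_if_cross_norm_preserving:
  fixes p1 p2 p3 :: "real^3"
  defines "T \<equiv> \<lambda>u::real^3. u$1 *\<^sub>R p1 + u$2 *\<^sub>R p2 + u$3 *\<^sub>R p3"
  assumes T: "\<And>u w. norm (T u \<times> T w) = norm (u \<times> w)"
  obtains d :: real where "d \<in> {-1, 1}" "p1 \<bullet> p1 = 1" "p2 \<bullet> p2 = 1" "p1 \<bullet> p2 = 0" "p3 = d *\<^sub>R (p1 \<times> p2)"
proof -
  define n1 n2 n3 where n: "n1 = p2 \<times> p3" "n2 = p3 \<times> p1" "n3 = p1 \<times> p2"
  have T_sq: "(T u \<times> T w) \<bullet> (T u \<times> T w) = (u \<times> w) \<bullet> (u \<times> w)" for u w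
    using T[of u w] by (simp flip: power2_norm_eq_inner)
  have T_cross: "T u \<times> T w = (u \<times> w)$1 *\<^sub>R n1 + (u \<times> w)$2 *\<^sub>R n2 + (u \<times> w)$3 *\<^sub>R n3" for u w
    unfolding n T_def vec_eq_iff forall_3 by (simp add: cross_components) (simp add: algebra_simps)
  note sq = T_sq[unfolded T_cross, simplified cross_components]
  let ?v = "\<lambda>a b c. vector [a, b, c] :: real^3"
  have nn: "n1 \<bullet> n1 = 1" "n2 \<bullet> n2 = 1" "n3 \<bullet> n3 = 1"
    using sq[of "?v 0 1 0" "?v 0 0 1"] sq[of "?v 0 0 1" "?v 1 0 0"] sq[of "?v 1 0 0" "?v 0 1 0"]
    by (simp_all add: inner_vec_def sum_3 cross_components)
  \<comment> \<open>Up to sign these cross products are sums of two axis vectors, so each sum of two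
    of the \<open>n\<close>s has squared length 2.\<close>
  have n_orth: "n1 \<bullet> n2 = 0" "n2 \<bullet> n3 = 0" "n1 \<bullet> n3 = 0"
    using sq[of "?v 1 (-1) 0" "?v 0 0 1"] sq[of "?v 0 1 (-1)" "?v 1 0 0"] sq[of "?v 1 0 (-1)" "?v 0 1 0"] nn
    by (simp_all add: inner_add_left inner_add_right inner_diff_left inner_diff_right inner_commute inner_vec_def[of "_ \<times> _"] sum_3 cross_components)
  define d where "d = p1 \<bullet> (p2 \<times> p3)"
  have dp: "n1 \<times> n2 = d *\<^sub>R p3" "n2 \<times> n3 = d *\<^sub>R p1" "n3 \<times> n1 = d *\<^sub>R p2"
    unfolding n d_def vec_eq_iff forall_3
    by (simp_all add: cross_components inner_vec_def sum_3) (simp_all add: algebra_simps)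
  have gram: "d\<^sup>2 * (p1 \<bullet> p1) = 1" "d\<^sup>2 * (p2 \<bullet> p2) = 1" "d\<^sup>2 * (p3 \<bullet> p3) = 1" "d\<^sup>2 * (p1 \<bullet> p2) = 0"
    using dot_cross[of n2 n3 n2 n3] dot_cross[of n3 n1 n3 n1] dot_cross[of n1 n2 n1 n2] dot_cross[of n2 n3 n3 n1] nn n_orth
    by (simp_all add: dp power2_eq_square inner_commute)
  then have "d \<noteq> 0" by auto
  then have p12: "p1 \<bullet> p2 = 0"
    using gram(4) by simp
  have "p1 \<bullet> p1 = p2 \<bullet> p2"
    using gram(1,2) \<open>d \<noteq> 0\<close> by (metis mult_cancel_left zero_eq_power2)
  moreover have "(p1 \<bullet> p1) * (p2 \<bullet> p2) = 1"
    using dot_cross[of p1 p2 p1 p2] nn(3) p12 by (simp add: n inner_commute)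
  ultimately have p1: "p1 \<bullet> p1 = 1" "p2 \<bullet> p2 = 1"
    using inner_ge_zero[of p2] by (auto simp: square_eq_1_iff)
  then have "d\<^sup>2 = 1"
    using gram(1) by simp
  then have d: "d \<in> {-1, 1}"
    by (auto simp: power2_eq_1_iff)
  have "p3 \<bullet> n3 = d"
    unfolding n d_def using cross_triple[of p1 p2 p3] by (simp add: inner_commute)
  then have "(p3 - d *\<^sub>R n3) \<bullet> (p3 - d *\<^sub>R n3) = 0"
    using nn(3) gram(3) \<open>d\<^sup>2 = 1\<close>
    by (simp add: inner_diff_left inner_diff_right inner_commute power2_eq_square)
  then show ?thesis
    using that[OF d p1 p12] by (simp add: n)
qed

text \<open>\<open>(F A \<bullet> z)^2\<close> is linear in \<open>outer_square (v A)\<close>, so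
  the squares at the axis vectors and their pairwise sums determine \<open>F\<close> up to sign.
  Each pairwise sum goes to a sum or difference of images; two of the three signs are absorbed into
  the \<open>p\<close>s, and the third must then be positive.\<close>

lemma cross_norm_preserving_orthonormal:
  fixes F v :: "'a \<Rightarrow> real^3"
  assumes surj: "surj v" and cross: "\<And>A B. norm (F A \<times> F B) = norm (v A \<times> v B)"
  obtains p1 p2 p3 where "p1 \<bullet> p1 = 1" "p2 \<bullet> p2 = 1" "p1 \<bullet> p2 = 0" "p3 = p1 \<times> p2"
    "\<forall>A. let y = v A $ 1 *\<^sub>R p1 + v A $ 2 *\<^sub>R p2 + v A $ 3 *\<^sub>R p3 in F A = y \<or> F A = - y"
proof -
  obtain L where L: "linear L" "surj L" "\<And>A. outer_square (F A) = L (outer_square (v A))"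
    using cross_norm_preserving_quadratic[OF surj cross] by blast
  define Q where "Q z X = L X \<bullet> (fst (outer_square z), 2 *\<^sub>R snd (outer_square z))" for z X
  have Q_linear: "linear (Q z)" for z
    using linear_compose[OF L(1) bounded_linear.linear[OF bounded_linear_inner_left]]
    unfolding Q_def o_def .
  note Q_simps = linear_add[OF Q_linear] linear_diff[OF Q_linear] linear_cmul[OF Q_linear]
  have Q: "(F A \<bullet> z)\<^sup>2 = Q z (outer_square (v A))" for A z
    unfolding Q_def by (simp add: inner_square_eq L(3))
  \<comment> \<open>If all values of \<open>F\<close> were orthogonal to \<open>z\<close>, then
    \<open>Q z\<close> would vanish on a spanning set; since \<open>L\<close> is onto, this includes
    a preimage of \<open>outer_square z\<close>, where \<open>Q z\<close> is
    \<open>(z \<bullet> z)^2\<close>.\<close>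
  have nondeg: "z = 0" if "\<And>A. F A \<bullet> z = 0" for z
  proof -
    have "Q z (outer_square w) = 0" for w
      using Q[of "inv v w" z] that surj by (simp add: surj_f_inv_f)
    then have "Q z X = 0" for X
      using linear_eq_on[OF Q_linear linear_zero, of X "range outer_square"] span_outer_squares by blast
    then have "(z \<bullet> z)\<^sup>2 = 0"
      using \<open>surj L\<close> unfolding inner_square_eq[of z z] Q_def by (metis surjD)
    then show ?thesis by simp
  qed
  \<comment> \<open>\<open>G\<close> fixes one preimage per vector; other preimages change the value
    of \<open>F\<close> only by a sign, which is \<open>F_G\<close> below.\<close>
  define G where "G w = F (inv v w)" for w
  have G: "(G w \<bullet> z)\<^sup>2 = Q z (outer_square w)" for w z
    unfolding G_def Q by (simp add: surj surj_f_inv_f)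
  have G_cross: "norm (G u \<times> G w) = norm (u \<times> w)" for u w
    unfolding G_def cross by (simp add: surj surj_f_inv_f)
  have F_G: "F A = G (v A) \<or> F A = - G (v A)" for A
    by (rule eq_or_eq_minus_if_inner_squares_eq) (simp add: Q G)
  have parallelogram: "(G (u + w) \<bullet> z)\<^sup>2 + (G (u - w) \<bullet> z)\<^sup>2 = 2 * (G u \<bullet> z)\<^sup>2 + 2 * (G w \<bullet> z)\<^sup>2" for u w z
  proof -
    have "outer_square (u + w) + outer_square (u - w) = 2 *\<^sub>R outer_square u + 2 *\<^sub>R outer_square w"
      by (simp add: outer_square_def prod_eq_iff vec_eq_iff forall_3 power2_eq_square algebra_simps)
    then show ?thesis
      unfolding G by (metis Q_simps(1,3) real_scaleR_def)
  qed
  define e1 e2 e3 :: "real^3" where e: "e1 = axis 1 1" "e2 = axis 2 1" "e3 = axis 3 1"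
  have norms: "norm (e1 \<times> e2) = 1" "norm (e1 \<times> e3) = 1" "norm (e2 \<times> e3) = 1"
    "norm ((e1 + e2) \<times> e1) = 1" "norm ((e1 + e2) \<times> e2) = 1" "norm ((e1 + e3) \<times> e1) = 1"
    "norm ((e1 + e3) \<times> e3) = 1" "norm ((e2 + e3) \<times> e2) = 1" "norm ((e2 + e3) \<times> e3) = 1"
    unfolding e by (simp_all add: cross_add_left cross_basis)
  obtain d12 where d12: "d12 \<in> {-1, 1}" "\<And>z. (G (e1 + e2) \<bullet> z)\<^sup>2 = (G e1 \<bullet> z + d12 * (G e2 \<bullet> z))\<^sup>2"
    using quadratic_pair_sum_or_diff[OF parallelogram[of e1 e2]] norms G_cross by metis
  obtain d13 where d13: "d13 \<in> {-1, 1}" "\<And>z. (G (e1 + e3) \<bullet> z)\<^sup>2 = (G e1 \<bullet> z + d13 * (G e3 \<bullet> z))\<^sup>2"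
    using quadratic_pair_sum_or_diff[OF parallelogram[of e1 e3]] norms G_cross by metis
  obtain d23 where d23: "d23 \<in> {-1, 1}" "\<And>z. (G (e2 + e3) \<bullet> z)\<^sup>2 = (G e2 \<bullet> z + d23 * (G e3 \<bullet> z))\<^sup>2"
    using quadratic_pair_sum_or_diff[OF parallelogram[of e2 e3]] norms G_cross by metis
  \<comment> \<open>Absorbing \<open>d12\<close> and \<open>d13\<close> makes the mixed terms with
    \<open>p1\<close> those of a perfect square; the mixed term of \<open>p2\<close> and
    \<open>p3\<close> keeps the sign \<open>d\<close>.\<close>
  define p1 p2 p3 d where p: "p1 = G e1" "p2 = d12 *\<^sub>R G e2" "p3 = d13 *\<^sub>R G e3" and d: "d = d12 * d13 * d23"
  have expand: "(G w \<bullet> z)\<^sup>2 = (w$1 * (p1 \<bullet> z) + w$2 * (p2 \<bullet> z) + w$3 * (p3 \<bullet> z))\<^sup>2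
      + 2 * (d - 1) * w$2 * w$3 * (p2 \<bullet> z) * (p3 \<bullet> z)" for w z
  proof -
    let ?P = outer_square
    have "?P w = (w$1)\<^sup>2 *\<^sub>R ?P e1 + (w$2)\<^sup>2 *\<^sub>R ?P e2 + (w$3)\<^sup>2 *\<^sub>R ?P e3
        + (w$1 * w$2) *\<^sub>R (?P (e1 + e2) - ?P e1 - ?P e2)
        + (w$1 * w$3) *\<^sub>R (?P (e1 + e3) - ?P e1 - ?P e3)
        + (w$2 * w$3) *\<^sub>R (?P (e2 + e3) - ?P e2 - ?P e3)"
      by (simp add: outer_square_def prod_eq_iff vec_eq_iff forall_3 axis_def e)
    then have "(G w \<bullet> z)\<^sup>2 = (w$1)\<^sup>2 * (G e1 \<bullet> z)\<^sup>2 + (w$2)\<^sup>2 * (G e2 \<bullet> z)\<^sup>2 + (w$3)\<^sup>2 * (G e3 \<bullet> z)\<^sup>2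
        + (w$1 * w$2) * ((G (e1 + e2) \<bullet> z)\<^sup>2 - (G e1 \<bullet> z)\<^sup>2 - (G e2 \<bullet> z)\<^sup>2)
        + (w$1 * w$3) * ((G (e1 + e3) \<bullet> z)\<^sup>2 - (G e1 \<bullet> z)\<^sup>2 - (G e3 \<bullet> z)\<^sup>2)
        + (w$2 * w$3) * ((G (e2 + e3) \<bullet> z)\<^sup>2 - (G e2 \<bullet> z)\<^sup>2 - (G e3 \<bullet> z)\<^sup>2)"
      unfolding G by (simp only: Q_simps real_scaleR_def)
    then show ?thesis
      unfolding d12(2) d13(2) d23(2) p d using d12(1) d13(1) d23(1)
      by (auto simp: power2_eq_square algebra_simps)
  qed
  have p_cross: "norm (p1 \<times> p2) = 1" "norm (p2 \<times> p3) = 1"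
    using d12(1) d13(1) G_cross[of e1 e2] G_cross[of e2 e3] norms unfolding p by auto
  \<comment> \<open>For \<open>d = -1\<close> the form \<open>expand\<close> at \<open>w = e1 + e2 + e3\<close> would have rank 3, but \<open>(G w \<bullet> z)\<^sup>2\<close> has rank 1.\<close>
  have "d \<noteq> -1"
  proof
    assume "d = -1"
    define r where "r = G (e1 + e2 + e3)"
    define D where "D = p1 \<bullet> (p2 \<times> p3)"
    have "D \<noteq> 0"
    proof
      assume "D = 0"
      then have "(G w \<bullet> (p2 \<times> p3))\<^sup>2 = 0" for w
        unfolding expand D_def by (simp add: dot_cross_self)
      then have "F A \<bullet> (p2 \<times> p3) = 0" for A
        using F_G[of A] by auto
      then show False
        using nondeg p_cross(2) by fastforce
    qed
    \<comment> \<open>The basis dual to \<open>p1\<close>, \<open>p2\<close>,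
      \<open>p3\<close>.\<close>
    define z1 z2 z3 where z: "z1 = (1/D) *\<^sub>R (p2 \<times> p3)" "z2 = (1/D) *\<^sub>R (p3 \<times> p1)" "z3 = (1/D) *\<^sub>R (p1 \<times> p2)"
    have dual: "p1 \<bullet> z1 = 1" "p2 \<bullet> z2 = 1" "p3 \<bullet> z3 = 1"
      "p1 \<bullet> z2 = 0" "p1 \<bullet> z3 = 0" "p2 \<bullet> z1 = 0" "p2 \<bullet> z3 = 0" "p3 \<bullet> z1 = 0" "p3 \<bullet> z2 = 0"
      unfolding z using \<open>D \<noteq> 0\<close>
      by (simp_all add: dot_cross_self D_def[symmetric])
        (simp_all add: D_def inner_vec_def sum_3 cross_components divide_simps, simp_all add: algebra_simps)
    have r: "(r \<bullet> z)\<^sup>2 = ((p1 \<bullet> z) + (p2 \<bullet> z) + (p3 \<bullet> z))\<^sup>2 - 4 * (p2 \<bullet> z) * (p3 \<bullet> z)" for z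
      unfolding r_def expand \<open>d = -1\<close> by (simp add: e axis_def)
    \<comment> \<open>The right side of \<open>r\<close> vanishes at all three test vectors.
      Together they force \<open>r \<bullet> z1 = 0\<close>, while \<open>r\<close> at
      \<open>z1\<close> gives 1.\<close>
    have "r \<bullet> (z2 + z3) = 0" "r \<bullet> (z2 - z1) = 0" "r \<bullet> (z3 - z1) = 0"
      using r[of "z2 + z3"] r[of "z2 - z1"] r[of "z3 - z1"] dual
      by (simp_all add: inner_add_right inner_diff_right)
    then have "r \<bullet> z1 = 0"
      by (simp add: inner_add_right inner_diff_right)
    then show False
      using r[of z1] dual by simp
  qed
  then have "d = 1"
    using d12(1) d13(1) d23(1) by (auto simp: d)
  define T where "T w = w$1 *\<^sub>R p1 + w$2 *\<^sub>R p2 + w$3 *\<^sub>R p3" for w :: "real^3"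
  have G_T: "G w = T w \<or> G w = - T w" for w
    by (rule eq_or_eq_minus_if_inner_squares_eq)
      (simp add: expand \<open>d = 1\<close> T_def inner_add_left)
  have "norm (T u \<times> T w) = norm (u \<times> w)" for u w
    using G_T[of u] G_T[of w] G_cross[of u w] by auto
  then obtain c where c: "c \<in> {-1, 1}" "p1 \<bullet> p1 = 1" "p2 \<bullet> p2 = 1" "p1 \<bullet> p2 = 0" "p3 = c *\<^sub>R (p1 \<times> p2)"
    using orthonormal_if_cross_norm_preserving[of p1 p2 p3] unfolding T_def by metis
  have "F A = T (v A) \<or> F A = - T (v A)" for A
    using F_G[of A] G_T[of "v A"] by auto
  \<comment> \<open>Multiplying all three vectors by \<open>c\<close> turns a left-handed frame into
    a right-handed one, since the dimension is odd; the overall sign is harmless in the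
    conclusion.\<close>
  moreover have "c *\<^sub>R T w = w$1 *\<^sub>R (c *\<^sub>R p1) + w$2 *\<^sub>R (c *\<^sub>R p2) + w$3 *\<^sub>R (c *\<^sub>R p3)" for w
    unfolding T_def by (simp add: scaleR_add_right mult.commute)
  ultimately have "\<forall>A. let y = v A $ 1 *\<^sub>R (c *\<^sub>R p1) + v A $ 2 *\<^sub>R (c *\<^sub>R p2) + v A $ 3 *\<^sub>R (c *\<^sub>R p3)
      in F A = y \<or> F A = - y"
    using c(1) unfolding Let_def by (metis insertE singletonD minus_minus scaleR_minus1_left scaleR_one)
  then show ?thesis
    using c by (intro that[of "c *\<^sub>R p1" "c *\<^sub>R p2" "c *\<^sub>R p3"]) auto
qed

subsection \<open>Hermitian matrices as vectors\<close>

definition pauli :: "real^3 \<Rightarrow> complex^2^2" where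
  "pauli w = vector [vector [of_real (w$3), Complex (w$1) (- (w$2))],
                     vector [Complex (w$1) (w$2), of_real (- (w$3))]]"

definition bloch :: "complex^2^2 \<Rightarrow> real^3" where
  "bloch A = vector [Re (A$1$2), - Im (A$1$2), Re (A$1$1 - A$2$2) / 2]"

definition half_trace :: "complex^2^2 \<Rightarrow> real" where
  "half_trace A = Re (A$1$1 + A$2$2) / 2"

lemmas matrix2_simps = vec_eq_iff forall_2 forall_3 sum_2 sum_3 matrix_matrix_mult_def
  matrix_vector_mult_def mat_def pauli_def cross_components inner_vec_def complex_eq_iff

lemma H2_pauli_decomposition:
  assumes "A \<in> H2"
  shows "A = pauli (bloch A) + half_trace A *\<^sub>R mat 1"
proof -
  have "cnj (A$j$i) = A$i$j" for i j
    using assms by (simp add: hermitian_def adj_def vec_eq_iff)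
  from this[of 1 1] this[of 1 2] this[of 2 2] show ?thesis
    by (simp add: matrix2_simps bloch_def half_trace_def) (simp add: field_simps)
qed

lemma pauli_in_H2: "pauli w \<in> H2"
  by (simp add: hermitian_def adj_def matrix2_simps)

lemma linear_pauli: "linear pauli"
  by (rule linearI) (simp_all add: matrix2_simps algebra_simps)

lemma pauli_mult: "pauli u ** pauli v = mat (of_real (u \<bullet> v)) + mat \<i> ** pauli (u \<times> v)"
  by (simp add: matrix2_simps)

lemma lie_H2:
  assumes "A \<in> H2" "B \<in> H2"
  shows "lie A B = mat \<i> ** pauli (2 *\<^sub>R (bloch A \<times> bloch B))"
proof -
  have "lie (pauli u + s *\<^sub>R mat 1) (pauli v + t *\<^sub>R mat 1) = mat \<i> ** pauli (2 *\<^sub>R (u \<times> v))" for u v s t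
    by (simp add: lie_def matrix2_simps) (simp add: algebra_simps)
  then show ?thesis
    using H2_pauli_decomposition assms by metis
qed

section \<open>Spectrum, numerical range and numerical radius of skew Pauli matrices\<close>

lemma det_skew_pauli: "det (mat \<i> ** pauli w) = of_real ((norm w)\<^sup>2)"
  unfolding power2_norm_eq_inner by (simp add: det_2 matrix2_simps power2_eq_square)

lemma spectrum_skew_pauli: "spectrum (mat \<i> ** pauli w) = {z. z\<^sup>2 = - of_real ((norm w)\<^sup>2)}"
proof -
  have "det (mat \<i> ** pauli w - mat z) = z\<^sup>2 + of_real ((norm w)\<^sup>2)" for z
    unfolding power2_norm_eq_inner
    by (simp add: det_2 matrix2_simps) (simp add: power2_eq_square algebra_simps)
  then show ?thesis
    by (simp add: spectrum_def invertible_det_nz eq_neg_iff_add_eq_0)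
qed

text \<open>Since \<open>pauli r\<close> squares to the identity, it fixes every column of
  \<open>pauli r + mat 1\<close>, and the trace 2 of this matrix shows that some column is
  nonzero.\<close>

lemma pauli_eigenvector:
  assumes "norm r = 1"
  obtains x where "norm x = 1" "pauli r *v x = x"
proof -
  define M where "M = pauli r + mat 1"
  have "pauli r ** pauli r = mat 1"
    using assms by (simp add: pauli_mult norm_eq_1) (simp add: matrix2_simps)
  then have M: "pauli r ** M = M"
    unfolding M_def by (simp add: matrix_add_ldistrib)
  have "M$1$1 + M$2$2 = 2"
    by (simp add: M_def matrix2_simps)
  then have "column 1 M \<noteq> 0 \<or> column 2 M \<noteq> 0"
    by (auto simp: column_def vec_eq_iff forall_2)
  then obtain k where k: "column k M \<noteq> 0" by blast
  define x where "x = (1 / norm (column k M)) *\<^sub>R column k M"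
  have "pauli r *v column k M = column k M"
    using M by (simp add: column_def matrix_matrix_mult_def matrix_vector_mult_def vec_eq_iff)
  then have "pauli r *v x = x"
    unfolding x_def by (simp add: matrix_vector_mult_def vec_eq_iff flip: scaleR_sum_right)
  moreover have "norm x = 1"
    using k by (simp add: x_def)
  ultimately show ?thesis
    using that by blast
qed

text \<open>For unit \<open>x\<close> this is the point of the Bloch sphere with expectations
  \<open>\<langle>pauli w x, x\<rangle> = w \<bullet> spin x\<close>.\<close>

definition spin :: "complex^2 \<Rightarrow> real^3" where
  "spin x = vector [2 * Re (cnj (x$1) * x$2), 2 * Im (cnj (x$1) * x$2), (cmod (x$1))\<^sup>2 - (cmod (x$2))\<^sup>2]"

lemma norm_spin: "norm (spin x) = (norm x)\<^sup>2"
proof -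
  have "(norm (spin x))\<^sup>2 = ((norm x)\<^sup>2)\<^sup>2"
    unfolding power2_norm_eq_inner[of "spin x"] norm_vec_def[of x] L2_set_def
    by (simp add: spin_def inner_vec_def sum_2 sum_3 cmod_power2)
      (simp add: power2_eq_square algebra_simps)
  then show ?thesis
    by (rule power2_eq_imp_eq) simp_all
qed

lemma herm_inner_pauli: "herm_inner (pauli w *v x) x = of_real (w \<bullet> spin x)"
  by (simp add: herm_inner_def spin_def matrix2_simps cmod_power2)
    (simp add: power2_eq_square algebra_simps)

text \<open>Cauchy-Schwarz gives the bound, eigenvectors for the directions of \<open>w\<close> and
  \<open>- w\<close> attain the endpoints, and connectedness of the unit sphere fills the
  interval.\<close>

lemma range_spin_functional:
  "(\<lambda>x. w \<bullet> spin x) ` sphere 0 1 = {- norm w .. norm w}"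
proof
  have "\<bar>w \<bullet> spin x\<bar> \<le> norm w" if "norm x = 1" for x
    using Cauchy_Schwarz_ineq2[of w "spin x"] that by (simp add: norm_spin)
  then show "(\<lambda>x. w \<bullet> spin x) ` sphere 0 1 \<subseteq> {- norm w .. norm w}"
    by (force simp: abs_le_iff)
next
  have attained: "\<exists>x\<in>sphere 0 1. w \<bullet> spin x = s * norm w" if "s \<in> {-1, 1}" for s
  proof (cases "w = 0")
    case True
    then show ?thesis
      using vector_choose_size[of 1] by auto
  next
    case False
    define r where "r = (s / norm w) *\<^sub>R w"
    have "norm r = 1"
      using False that by (auto simp: r_def)
    then obtain x where x: "norm x = 1" "pauli r *v x = x"
      using pauli_eigenvector by blast
    then have "r \<bullet> spin x = 1"
      using herm_inner_pauli[of r x] herm_inner_self[of x] by (metis of_real_eq_iff power_one)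
    then have "w \<bullet> spin x = s * norm w"
      using False that by (auto simp: r_def field_simps)
    then show ?thesis
      using x(1) by auto
  qed
  have "connected ((\<lambda>x. w \<bullet> spin x) ` sphere 0 1)"
  proof (rule connected_continuous_image)
    show "continuous_on (sphere 0 1) (\<lambda>x. w \<bullet> spin x)"
      unfolding spin_def inner_vec_def sum_3 by (auto intro!: continuous_intros)
    show "connected (sphere (0 :: complex^2) 1)"
      by (rule connected_sphere) simp
  qed
  moreover have "- norm w \<in> (\<lambda>x. w \<bullet> spin x) ` sphere 0 1" "norm w \<in> (\<lambda>x. w \<bullet> spin x) ` sphere 0 1"
    using attained[of "-1"] attained[of 1] by force+
  ultimately show "{- norm w .. norm w} \<subseteq> (\<lambda>x. w \<bullet> spin x) ` sphere 0 1"
    by (rule connected_contains_Icc)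
qed

lemma num_range_skew_pauli:
  "num_range (mat \<i> ** pauli w) = (\<lambda>t. \<i> * of_real t) ` {- norm w .. norm w}"
proof -
  have "herm_inner ((mat \<i> ** pauli w) *v x) x = \<i> * herm_inner (pauli w *v x) x" for x
    by (simp add: herm_inner_def sum_2 matrix_matrix_mult_def matrix_vector_mult_def mat_def algebra_simps)
  then have "num_range (mat \<i> ** pauli w) = (\<lambda>x. \<i> * of_real (w \<bullet> spin x)) ` sphere 0 1"
    by (auto simp: num_range_def herm_inner_pauli)
  also have "\<dots> = (\<lambda>t. \<i> * of_real t) ` {- norm w .. norm w}"
    unfolding range_spin_functional[symmetric] by (simp add: image_image)
  finally show ?thesis .
qed

lemma num_radius_skew_pauli: "num_radius (mat \<i> ** pauli w) = norm w"
  unfolding num_radius_def num_range_skew_pauli image_image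
  by (rule cSup_eq_maximum) (auto simp: norm_mult intro!: image_eqI[of _ _ "norm w"])

lemma skew_pauli_equivalences:
  "spectrum (mat \<i> ** pauli u) = spectrum (mat \<i> ** pauli v) \<longleftrightarrow> norm u = norm v"
  "num_range (mat \<i> ** pauli u) = num_range (mat \<i> ** pauli v) \<longleftrightarrow> norm u = norm v"
proof -
  have "norm u = norm v" if "spectrum (mat \<i> ** pauli u) = spectrum (mat \<i> ** pauli v)"
  proof -
    have "\<i> * of_real (norm u) \<in> spectrum (mat \<i> ** pauli v)"
      unfolding that[symmetric] by (simp add: spectrum_skew_pauli power_mult_distrib)
    then have "(of_real ((norm u)\<^sup>2) :: complex) = of_real ((norm v)\<^sup>2)"
      by (simp add: spectrum_skew_pauli power_mult_distrib)
    then show ?thesis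
      unfolding of_real_eq_iff by simp
  qed
  then show "spectrum (mat \<i> ** pauli u) = spectrum (mat \<i> ** pauli v) \<longleftrightarrow> norm u = norm v"
    by (auto simp: spectrum_skew_pauli)
  show "num_range (mat \<i> ** pauli u) = num_range (mat \<i> ** pauli v) \<longleftrightarrow> norm u = norm v"
    using num_radius_skew_pauli unfolding num_radius_def by (metis num_range_skew_pauli)
qed

section \<open>Lifting rotations to unitary conjugations\<close>

lemma adj_mult: "adj (A ** B) = adj B ** adj A"
  by (simp add: adj_def matrix_matrix_mult_def vec_eq_iff mult.commute)

lemma uminus_matrix_vector: "(- A) *v x = - (A *v (x :: 'a::ring_1^'n))"
  by (simp add: matrix_vector_mult_def vec_eq_iff sum_negf)

text \<open>Commuting with the third Pauli matrix kills the off-diagonal entries, commuting with the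
  first equates the diagonal ones, and \<open>N$1$1\<close> fixes the scalar. Used to see that an
  intertwiner is unitary.\<close>

lemma eq_mat_1_if_commutes_pauli:
  assumes "N ** pauli (axis 1 1) = pauli (axis 1 1) ** N" "N ** pauli (axis 3 1) = pauli (axis 3 1) ** N"
    and "N$1$1 = 1"
  shows "N = mat 1"
proof -
  have "N$1$2 = N$2$1" "N$1$1 = N$2$2" "N$1$2 = - N$1$2"
    using arg_cong[OF assms(1), of "\<lambda>M. M$1$1"] arg_cong[OF assms(1), of "\<lambda>M. M$1$2"]
      arg_cong[OF assms(2), of "\<lambda>M. M$1$2"]
    unfolding matrix_matrix_mult_def sum_2 pauli_def by (simp_all add: axis_def Complex_eq)
  then show ?thesis
    using assms(3) by (simp add: vec_eq_iff forall_2 mat_def)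
qed

text \<open>The columns of \<open>U\<close> are a fixed unit vector \<open>x\<close> of
  \<open>pauli p3\<close> and its image under \<open>pauli p1\<close>. In this basis
  \<open>pauli p1\<close> swaps the two vectors, and \<open>pauli p3\<close>, which anticommutes
  with it, is diagonal with entries 1 and -1: the standard Pauli matrices.\<close>

lemma pauli_unitary_conjugation:
  fixes p1 p2 p3 :: "real^3"
  assumes p: "p1 \<bullet> p1 = 1" "p2 \<bullet> p2 = 1" "p1 \<bullet> p2 = 0" "p3 = p1 \<times> p2"
  obtains U where "unitary U"
    "\<And>v. U ** pauli v ** adj U = pauli (v$1 *\<^sub>R p1 + v$2 *\<^sub>R p2 + v$3 *\<^sub>R p3)"
proof -
  let ?e = "\<lambda>i. axis i 1 :: real^3"
  have p3: "p3 \<bullet> p3 = 1" "p3 \<times> p1 = p2" "p1 \<times> p3 = - p2" "p1 \<bullet> p3 = 0" "p3 \<bullet> p1 = 0"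
    using p by (simp_all add: dot_cross Lagrange dot_cross_self inner_commute cross_skew[of "p1 \<times> p2"])
  obtain x where x: "norm x = 1" "pauli p3 *v x = x"
    using pauli_eigenvector[of p3] p3(1) by (auto simp: norm_eq_1)
  define U :: "complex^2^2" where "U = (\<chi> i j. if j = 1 then x$i else (pauli p1 *v x)$i)"
  have "pauli p1 ** pauli p1 = mat 1"
    by (simp add: pauli_mult p) (simp add: matrix2_simps)
  then have S1S1: "pauli p1 *v (pauli p1 *v x) = x"
    by (simp add: matrix_vector_mul_assoc)
  have "pauli p3 ** pauli p1 = - (pauli p1 ** pauli p3)"
    by (simp add: pauli_mult p3) (simp add: matrix2_simps)
  then have S3S1: "pauli p3 *v (pauli p1 *v x) = - (pauli p1 *v x)"
    using x(2) by (simp add: matrix_vector_mul_assoc)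
      (simp add: matrix_vector_mul_assoc[symmetric] uminus_matrix_vector)
  have mult_U: "M ** U = (\<chi> i j. if j = 1 then (M *v x)$i else (M *v (pauli p1 *v x))$i)" for M
    unfolding U_def by (simp add: matrix_matrix_mult_def matrix_vector_mult_def vec_eq_iff)
  have U1: "pauli p1 ** U = U ** pauli (?e 1)"
    unfolding mult_U S1S1
    by (simp add: U_def vec_eq_iff forall_2 matrix_matrix_mult_def sum_2 pauli_def axis_def Complex_eq)
  have U3: "pauli p3 ** U = U ** pauli (?e 3)"
    unfolding mult_U S3S1 x(2)
    by (simp add: U_def vec_eq_iff forall_2 matrix_matrix_mult_def sum_2 pauli_def axis_def Complex_eq)
  have adj_pauli: "adj (pauli w) = pauli w" for w
    using pauli_in_H2 by (simp add: hermitian_def)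
  have commutes: "(adj U ** U) ** pauli w = pauli w ** (adj U ** U)" if "pauli q ** U = U ** pauli w" for w q
  proof -
    have "(adj U ** U) ** pauli w = adj U ** (U ** pauli w)"
      by (rule matrix_mul_assoc[symmetric])
    also have "\<dots> = adj (pauli q ** U) ** U"
      by (simp only: that[symmetric] adj_mult adj_pauli matrix_mul_assoc)
    also have "\<dots> = pauli w ** (adj U ** U)"
      by (simp only: that adj_mult adj_pauli matrix_mul_assoc)
    finally show ?thesis .
  qed
  have "(adj U ** U)$1$1 = 1"
    using herm_inner_self[of x] x(1)
    by (simp add: matrix_matrix_mult_def adj_def U_def herm_inner_def mult.commute)
  then have UU: "adj U ** U = mat 1"
    by (rule eq_mat_1_if_commutes_pauli[OF commutes[OF U1] commutes[OF U3]])
  then have UU': "U ** adj U = mat 1"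
    using matrix_left_right_inverse by blast
  \<comment> \<open>The second generator is the product of the third and the first up to the factor
    \<open>\<i>\<close>; this is where the orientation \<open>p3 = p1 \<times> p2\<close>
    enters.\<close>
  have U2: "pauli p2 ** U = U ** pauli (?e 2)"
  proof -
    have pp: "mat \<i> ** pauli p2 = pauli p3 ** pauli p1" "mat \<i> ** pauli (?e 2) = pauli (?e 3) ** pauli (?e 1)"
      by (simp_all add: pauli_mult p3 cross_basis inner_axis_axis)
    have cancel: "mat (- \<i>) ** (mat \<i> ** X) = X" for X :: "complex^2^2"
      by (simp add: matrix_matrix_mult_def mat_def vec_eq_iff forall_2 sum_2)
    have "mat \<i> ** (pauli p2 ** U) = pauli p3 ** (U ** pauli (?e 1))"
      by (simp add: pp matrix_mul_assoc) (simp add: U1 flip: matrix_mul_assoc)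
    also have "\<dots> = U ** (mat \<i> ** pauli (?e 2))"
      by (simp add: pp matrix_mul_assoc U3)
    also have "\<dots> = mat \<i> ** (U ** pauli (?e 2))"
      by (simp add: matrix_matrix_mult_def mat_def vec_eq_iff forall_2 sum_2 algebra_simps)
    finally show ?thesis
      by (metis cancel)
  qed
  have conj: "U ** pauli w ** adj U = pauli q" if "pauli q ** U = U ** pauli w" for w q
    using UU' by (simp add: that[symmetric]) (simp flip: matrix_mul_assoc)
  have conj_linear: "linear (\<lambda>v. U ** pauli v ** adj U)"
    by (rule linearI)
      (simp_all add: linear_add[OF linear_pauli] linear_cmul[OF linear_pauli] vec_eq_iff forall_2
        matrix_matrix_mult_def sum_2 algebra_simps)
  have "U ** pauli v ** adj U = pauli (v$1 *\<^sub>R p1 + v$2 *\<^sub>R p2 + v$3 *\<^sub>R p3)" for v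
  proof -
    have "v = v$1 *\<^sub>R ?e 1 + v$2 *\<^sub>R ?e 2 + v$3 *\<^sub>R ?e 3"
      by (simp add: vec_eq_iff forall_3 axis_def)
    then have "U ** pauli v ** adj U = U ** pauli (v$1 *\<^sub>R ?e 1 + v$2 *\<^sub>R ?e 2 + v$3 *\<^sub>R ?e 3) ** adj U"
      by (rule arg_cong)
    also have "\<dots> = v$1 *\<^sub>R pauli p1 + v$2 *\<^sub>R pauli p2 + v$3 *\<^sub>R pauli p3"
      by (simp only: linear_add[OF conj_linear] linear_cmul[OF conj_linear] conj[OF U1] conj[OF U2] conj[OF U3])
    also have "\<dots> = pauli (v$1 *\<^sub>R p1 + v$2 *\<^sub>R p2 + v$3 *\<^sub>R p3)"
      by (simp only: linear_add[OF linear_pauli] linear_cmul[OF linear_pauli])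
    finally show ?thesis .
  qed
  then show ?thesis
    using that UU UU' by (auto simp: unitary_def)
qed

section \<open>Area invariance under conjugation, transposition and \<open>Psi\<close>\<close>

abbreviation area :: "complex^2^2 \<Rightarrow> complex^2^2 \<Rightarrow> real" where
  "area A B \<equiv> norm (bloch A \<times> bloch B)"

lemma det_lie_H2:
  assumes "A \<in> H2" "B \<in> H2"
  shows "det (lie A B) = of_real ((2 * area A B)\<^sup>2)"
  by (simp add: lie_H2 assms det_skew_pauli power_mult_distrib)

text \<open>The area is read off from \<open>det (lie A B)\<close>, which is invariant under unitary
  conjugation and, in even dimension, under the sign \<open>s * t\<close>; the scalar shifts cancel
  in the Lie product.\<close>

lemma area_conjugation:
  assumes U: "unitary U" and s: "s \<in> {-1, 1}" and t: "t \<in> {-1, 1}" and AB: "A \<in> H2" "B \<in> H2"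
    and A': "A' = s *\<^sub>R (U ** A ** adj U) + a *\<^sub>R mat 1" "A' \<in> H2"
    and B': "B' = t *\<^sub>R (U ** B ** adj U) + b *\<^sub>R mat 1" "B' \<in> H2"
  shows "area A' B' = area A B"
proof -
  have lie_affine: "lie (s *\<^sub>R X + a *\<^sub>R mat 1) (t *\<^sub>R Y + b *\<^sub>R mat 1) = (s * t) *\<^sub>R lie X Y" for X Y :: "complex^2^2"
    by (simp add: lie_def vec_eq_iff forall_2 matrix_matrix_mult_def sum_2 mat_def)
      (simp add: scaleR_conv_of_real algebra_simps)
  have det_sign: "det ((s * t) *\<^sub>R X) = det X" for X :: "complex^2^2"
    using s t by (auto simp: det_2)
  have UU: "adj U ** U = mat 1" "det U * det (adj U) = 1"
    using U by (auto simp: unitary_def simp flip: det_mul)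
  have cancel: "(U ** X ** adj U) ** (U ** Y ** adj U) = U ** (X ** Y) ** adj U" for X Y
  proof -
    have "(U ** X ** adj U) ** (U ** Y ** adj U) = U ** X ** (adj U ** U) ** Y ** adj U"
      by (simp only: matrix_mul_assoc)
    then show ?thesis
      by (simp add: UU matrix_mul_assoc)
  qed
  have "lie (U ** A ** adj U) (U ** B ** adj U) = U ** lie A B ** adj U"
    unfolding lie_def cancel
    by (simp add: vec_eq_iff forall_2 matrix_matrix_mult_def sum_2) (simp add: algebra_simps)
  then have "det (lie A' B') = det U * det (lie A B) * det (adj U)"
    unfolding A'(1) B'(1) by (simp add: lie_affine det_sign det_mul)
  also have "\<dots> = det (lie A B)"
    using UU(2) by (metis mult.assoc mult.commute mult_1)
  finally have "(2 * area A' B')\<^sup>2 = (2 * area A B)\<^sup>2"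
    using AB A'(2) B'(2) by (simp only: det_lie_H2 of_real_eq_iff)
  then show ?thesis
    by (simp add: power_mult_distrib)
qed

text \<open>Negating one coordinate of both factors only flips the two components of the cross
  product that involve it.\<close>

lemma norm_cross_reflect1:
  "norm (vector [- u$1, u$2, u$3] \<times> vector [- v$1, v$2, v$3] :: real^3) = norm (u \<times> v)"
  by (simp add: norm_eq inner_vec_def sum_3 cross_components) (simp add: algebra_simps)

lemma norm_cross_reflect2:
  "norm (vector [u$1, - u$2, u$3] \<times> vector [v$1, - v$2, v$3] :: real^3) = norm (u \<times> v)"
  by (simp add: norm_eq inner_vec_def sum_3 cross_components) (simp add: algebra_simps)

lemma area_Psi: "area (Psi A) (Psi B) = area A B"
proof -
  have "bloch (Psi A) = vector [- bloch A$1, bloch A$2, bloch A$3]" for A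
    by (simp add: bloch_def Psi_def)
  then show ?thesis
    by (simp add: norm_cross_reflect1)
qed

lemma transpose_in_H2: "A \<in> H2 \<Longrightarrow> transpose A \<in> H2"
  by (simp add: hermitian_def adj_def transpose_def vec_eq_iff)

lemma area_transpose:
  assumes "A \<in> H2" "B \<in> H2"
  shows "area (transpose A) (transpose B) = area A B"
proof -
  have "bloch (transpose A) = vector [bloch A$1, - bloch A$2, bloch A$3]" if "A \<in> H2" for A
  proof -
    have "A$2$1 = cnj (A$1$2)"
      using that by (simp add: hermitian_def adj_def vec_eq_iff)
    then show ?thesis
      by (simp add: bloch_def transpose_def)
  qed
  then show ?thesis
    by (simp add: assms norm_cross_reflect2)
qed

section \<open>From area preservation to the classification\<close>

lemma area_preserving_form:
  assumes area: "\<And>A B. A \<in> H2 \<Longrightarrow> B \<in> H2 \<Longrightarrow> area (\<Phi> A) (\<Phi> B) = area A B"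
  obtains U h f where "unitary U" "h \<in> H2 \<rightarrow> {-1, 1 :: real}"
    "\<And>A. \<lbrakk>A \<in> H2; \<Phi> A \<in> H2\<rbrakk> \<Longrightarrow> \<Phi> A = h A *\<^sub>R (U ** A ** adj U) + f A *\<^sub>R mat 1"
proof -
  \<comment> \<open>Parametrising \<open>H2\<close> by scalar part and vector replaces the set by a
    whole type, with \<open>snd\<close> as the surjection onto vectors.\<close>
  define H where "H = (\<lambda>(t, w). pauli w + t *\<^sub>R mat 1)"
  have H: "H (t, w) \<in> H2" "bloch (H (t, w)) = w" for t w
    by (simp_all add: H_def hermitian_def adj_def bloch_def matrix2_simps)
  have H_decomposition: "A = H (half_trace A, bloch A)" if "A \<in> H2" for A
    using H2_pauli_decomposition[OF that] by (simp add: H_def)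
  have cross: "norm (bloch (\<Phi> (H A)) \<times> bloch (\<Phi> (H B))) = norm (snd A \<times> snd B)" for A B
    using area[OF H(1) H(1)] H(2) by (metis prod.collapse)
  have surj: "surj (snd :: real \<times> (real^3) \<Rightarrow> real^3)"
    by (rule surjI[of _ "Pair 0"]) simp
  obtain p1 p2 p3 where p: "p1 \<bullet> p1 = 1" "p2 \<bullet> p2 = 1" "p1 \<bullet> p2 = 0" "p3 = p1 \<times> p2"
    and \<Phi>: "\<forall>A. let y = snd A $ 1 *\<^sub>R p1 + snd A $ 2 *\<^sub>R p2 + snd A $ 3 *\<^sub>R p3 in
      bloch (\<Phi> (H A)) = y \<or> bloch (\<Phi> (H A)) = - y"
    by (rule cross_norm_preserving_orthonormal[OF surj cross])
  obtain U where U: "unitary U"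
    "\<And>v. U ** pauli v ** adj U = pauli (v$1 *\<^sub>R p1 + v$2 *\<^sub>R p2 + v$3 *\<^sub>R p3)"
    using pauli_unitary_conjugation[OF p] by blast
  define y where "y v = v$1 *\<^sub>R p1 + v$2 *\<^sub>R p2 + v$3 *\<^sub>R p3" for v :: "real^3"
  \<comment> \<open>When \<open>bloch A = 0\<close> both signs fit, and 1 is chosen.\<close>
  define h where "h A = (if bloch (\<Phi> A) = y (bloch A) then 1 else -1 :: real)" for A
  \<comment> \<open>Conjugation keeps the scalar part of \<open>A\<close>, so \<open>h A\<close>
    times it is subtracted from that of \<open>\<Phi> A\<close>.\<close>
  define f where "f A = half_trace (\<Phi> A) - h A * half_trace A" for A
  have "\<Phi> A = h A *\<^sub>R (U ** A ** adj U) + f A *\<^sub>R mat 1" if "A \<in> H2" "\<Phi> A \<in> H2" for A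
  proof -
    have "bloch (\<Phi> A) = h A *\<^sub>R y (bloch A)"
      using spec[OF \<Phi>, of "(half_trace A, bloch A)"] H_decomposition[OF that(1)]
      by (auto simp: Let_def h_def y_def)
    then have "\<Phi> A = h A *\<^sub>R pauli (y (bloch A)) + half_trace (\<Phi> A) *\<^sub>R mat 1"
      using H2_pauli_decomposition[OF that(2)] linear_cmul[OF linear_pauli] by metis
    moreover have "U ** A ** adj U = pauli (y (bloch A)) + half_trace A *\<^sub>R mat 1"
    proof -
      have "U ** (pauli v + t *\<^sub>R mat 1) ** adj U = U ** pauli v ** adj U + t *\<^sub>R (U ** adj U)" for v t
        by (simp add: vec_eq_iff forall_2 matrix_matrix_mult_def sum_2 mat_def)
          (simp add: scaleR_conv_of_real algebra_simps)
      then show ?thesis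
        using H2_pauli_decomposition[OF that(1)] U by (metis unitary_def y_def)
    qed
    ultimately show ?thesis
      by (simp add: f_def algebra_simps)
  qed
  then show ?thesis
    using that[of U h f] U(1) by (auto simp: h_def)
qed

theorem theorem4p1:
  fixes \<Phi> :: "complex^2^2 \<Rightarrow> complex^2^2"
  assumes "\<Phi> \<in> H2 \<rightarrow> H2"
  shows
    "((\<forall>A\<in>H2. \<forall>B\<in>H2. spectrum (lie (\<Phi> A) (\<Phi> B)) = spectrum (lie A B))
      \<longleftrightarrow> (\<forall>A\<in>H2. \<forall>B\<in>H2. num_range (lie (\<Phi> A) (\<Phi> B)) = num_range (lie A B))) \<and>
     ((\<forall>A\<in>H2. \<forall>B\<in>H2. num_range (lie (\<Phi> A) (\<Phi> B)) = num_range (lie A B))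
      \<longleftrightarrow> (\<forall>A\<in>H2. \<forall>B\<in>H2. num_radius (lie (\<Phi> A) (\<Phi> B)) = num_radius (lie A B))) \<and>
     ((\<forall>A\<in>H2. \<forall>B\<in>H2. num_radius (lie (\<Phi> A) (\<Phi> B)) = num_radius (lie A B))
      \<longleftrightarrow> (\<exists>(U :: complex^2^2) (h :: complex^2^2 \<Rightarrow> real) (f :: complex^2^2 \<Rightarrow> real).
           unitary U \<and> h \<in> H2 \<rightarrow> {-1, 1} \<and>
           ((\<forall>A\<in>H2. \<Phi> A = h A *\<^sub>R (U ** A ** adj U) + f A *\<^sub>R mat 1) \<or>
            (\<forall>A\<in>H2. \<Phi> A = h A *\<^sub>R (U ** transpose A ** adj U) + f A *\<^sub>R mat 1) \<or>
            (\<forall>A\<in>H2. \<Phi> A = h A *\<^sub>R (U ** Psi A ** adj U) + f A *\<^sub>R mat 1) \<or>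
            (\<forall>A\<in>H2. \<Phi> A = h A *\<^sub>R (U ** transpose (Psi A) ** adj U) + f A *\<^sub>R mat 1))))"
proof -
  have \<Phi>: "\<Phi> A \<in> H2" if "A \<in> H2" for A
    using assms that by blast
  note equivalences = lie_H2 \<Phi> skew_pauli_equivalences num_radius_skew_pauli
  \<comment> \<open>The hub of the theorem: each of the three preservation conditions, and the
    classification, is compared with this one.\<close>
  let ?area = "\<forall>A\<in>H2. \<forall>B\<in>H2. area (\<Phi> A) (\<Phi> B) = area A B"
  let ?form = "\<lambda>\<tau>. \<exists>U h f. unitary U \<and> h \<in> H2 \<rightarrow> {-1, 1 :: real} \<and>
    (\<forall>A\<in>H2. \<Phi> A = h A *\<^sub>R (U ** \<tau> A ** adj U) + f A *\<^sub>R mat 1)"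
  have spectrum: "(\<forall>A\<in>H2. \<forall>B\<in>H2. spectrum (lie (\<Phi> A) (\<Phi> B)) = spectrum (lie A B)) \<longleftrightarrow> ?area"
    by (simp add: equivalences)
  have num_range: "(\<forall>A\<in>H2. \<forall>B\<in>H2. num_range (lie (\<Phi> A) (\<Phi> B)) = num_range (lie A B)) \<longleftrightarrow> ?area"
    by (simp add: equivalences)
  have num_radius: "(\<forall>A\<in>H2. \<forall>B\<in>H2. num_radius (lie (\<Phi> A) (\<Phi> B)) = num_radius (lie A B)) \<longleftrightarrow> ?area"
    by (simp add: equivalences)
  have area_if_form: ?area if "?form \<tau>" and \<tau>: "\<And>A. A \<in> H2 \<Longrightarrow> \<tau> A \<in> H2"
    "\<And>A B. A \<in> H2 \<Longrightarrow> B \<in> H2 \<Longrightarrow> area (\<tau> A) (\<tau> B) = area A B" for \<tau>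
  proof (intro ballI)
    fix A B :: "complex^2^2" assume AB: "A \<in> H2" "B \<in> H2"
    obtain U h f where U: "unitary U" and h: "h \<in> H2 \<rightarrow> {-1, 1 :: real}"
      and form: "\<And>A. A \<in> H2 \<Longrightarrow> \<Phi> A = h A *\<^sub>R (U ** \<tau> A ** adj U) + f A *\<^sub>R mat 1"
      using \<open>?form \<tau>\<close> by blast
    have "area (\<Phi> A) (\<Phi> B) = area (\<tau> A) (\<tau> B)"
      by (rule area_conjugation[OF U funcset_mem[OF h AB(1)] funcset_mem[OF h AB(2)]
            \<tau>(1)[OF AB(1)] \<tau>(1)[OF AB(2)] form[OF AB(1)] \<Phi>[OF AB(1)] form[OF AB(2)] \<Phi>[OF AB(2)]])
    then show "area (\<Phi> A) (\<Phi> B) = area A B"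
      using \<tau>(2) AB by simp
  qed
  \<comment> \<open>\<open>?area\<close> yields the first form directly; conversely, each form
    conjugates some \<open>\<tau>\<close> that preserves both \<open>H2\<close> and
    \<open>area\<close>.\<close>
  have "?area \<longleftrightarrow> (?form (\<lambda>A. A) \<or> ?form transpose \<or> ?form Psi \<or> ?form (\<lambda>A. transpose (Psi A)))"
  proof
    assume ?area
    then obtain U h f where "unitary U" "h \<in> H2 \<rightarrow> {-1, 1 :: real}"
      "\<And>A. \<lbrakk>A \<in> H2; \<Phi> A \<in> H2\<rbrakk> \<Longrightarrow> \<Phi> A = h A *\<^sub>R (U ** A ** adj U) + f A *\<^sub>R mat 1"
      using area_preserving_form[of \<Phi>] by blast
    then have "?form (\<lambda>A. A)"
      using \<Phi> by blast
    then show "?form (\<lambda>A. A) \<or> ?form transpose \<or> ?form Psi \<or> ?form (\<lambda>A. transpose (Psi A))" ..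
  next
    assume "?form (\<lambda>A. A) \<or> ?form transpose \<or> ?form Psi \<or> ?form (\<lambda>A. transpose (Psi A))"
    then show ?area
      by (elim disjE; elim area_if_form)
        (simp_all add: area_Psi area_transpose Psi_in_H2 transpose_in_H2)
  qed
  then show ?thesis
    unfolding spectrum num_range num_radius by blast
qed

end
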